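(* Let $R$ be a Poisson ${\bf k}$-algebra with Poisson bracket $\{-,-\}_R$ and let $R[y_1,y_2]$ be the commutative polynomial ring over $R$. Let $q=\{q_{11},q_{12}\}\subset{\bf k}$, $w=\{w_1,w_2,w_0\}\subset R$, and let $$\alpha:R\to M_{2\times2}(R),\ \ \alpha(a)=\begin{pmatrix}\alpha_{11}(a)&\alpha_{12}(a)\\ \alpha_{21}(a)&\alpha_{22}(a)\end{pmatrix},\qquad \nu:R\to M_{2\times1}(R),\ \ \nu(a)=\begin{pmatrix}\nu_1(a)\\ \nu_2(a)\end{pmatrix}$$ be ${\bf k}$-linear maps. Put $y=\begin{pmatrix} y_1 \\ y_2 \end{pmatrix}$. Then $R[y_1,y_2]$ becomes a Poisson algebra with a Poisson bracket $\{-,-\}$ such that $$\begin{aligned}\{a,b\}&=\{a,b\}_R,\\ \{y_2,y_1\}&=q_{11}y_1^2+q_{12}y_1y_2+w_1y_1+w_2y_2+w_0,\\ \{y_1,a\}&=\alpha_{11}(a)y_1+\alpha_{12}(a)y_2+\nu_1(a),\\ \{y_2,a\}&=\alpha_{21}(a)y_1+\alpha_{22}(a)y_2+\nu_2(a)\end{aligned}$$ for all $a,b\in R$ if and only if the following conditions (1)–(13) hold for all $a,b\in R$ (with $\{-,-\}=\{-,-\}_R$ in them): (1) $\alpha_{11},\alpha_{12},\alpha_{21},\alpha_{22},\nu_1,\nu_2$ are all derivations of $R$. (2) $\alpha_{11}(\{a,b\})-\{\alpha_{11}(a),b\}-\{a,\alpha_{11}(b)\}=\alpha_{12}(a)\alpha_{21}(b)-\alpha_{21}(a)\alpha_{12}(b)$.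 (3) $\alpha_{22}(\{a,b\})-\{\alpha_{22}(a),b\}-\{a,\alpha_{22}(b)\}=\alpha_{21}(a)\alpha_{12}(b)-\alpha_{12}(a)\alpha_{21}(b)$. (4) $\alpha_{12}(\{a,b\})-\{\alpha_{12}(a),b\}-\{a,\alpha_{12}(b)\}=\alpha_{11}(a)\alpha_{12}(b)-\alpha_{12}(a)\alpha_{11}(b)+\alpha_{12}(a)\alpha_{22}(b)-\alpha_{22}(a)\alpha_{12}(b)$. (5) $\alpha_{21}(\{a,b\})-\{\alpha_{21}(a),b\}-\{a,\alpha_{21}(b)\}=\alpha_{21}(a)\alpha_{11}(b)-\alpha_{11}(a)\alpha_{21}(b)+\alpha_{22}(a)\alpha_{21}(b)-\alpha_{21}(a)\alpha_{22}(b)$. (6) $\nu_1(\{a,b\})-\{\nu_1(a),b\}-\{a,\nu_1(b)\}=\alpha_{11}(a)\nu_1(b)-\nu_1(a)\alpha_{11}(b)+\alpha_{12}(a)\nu_2(b)-\nu_2(a)\alpha_{12}(b)$. (7) $\nu_2(\{a,b\})-\{\nu_2(a),b\}-\{a,\nu_2(b)\}=\alpha_{21}(a)\nu_1(b)-\nu_1(a)\alpha_{21}(b)+\alpha_{22}(a)\nu_2(b)-\nu_2(a)\alpha_{22}(b)$. (8) $[\alpha_{21},\alpha_{11}]=q_{11}\alpha_{11}+q_{12}\alpha_{21}-q_{11}\alpha_{22}$. (9) $[\alpha_{22},\alpha_{11}]+[\alpha_{21},\alpha_{12}]=2q_{11}\alpha_{12}$. (10) $[\alpha_{22},\alpha_{12}]=q_{12}\alpha_{12}$.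 (11) $[\nu_2,\alpha_{11}]+[\alpha_{21},\nu_1]=2q_{11}\nu_1+q_{12}\nu_2+w_2\alpha_{21}-w_1\alpha_{22}+\{w_1,-\}$. (12) $[\nu_2,\alpha_{12}]+[\alpha_{22},\nu_1]=q_{12}\nu_1+w_1\alpha_{12}-w_2\alpha_{11}+\{w_2,-\}$. (13) $[\nu_2,\nu_1]=w_1\nu_1+w_2\nu_2-w_0\alpha_{11}-w_0\alpha_{22}+\{w_0,-\}$. Equivalently: $R[y_1,y_2]$ becomes a Poisson algebra with Poisson bracket satisfying $\{a,b\}=\{a,b\}_R$, $\{y_2,y_1\}=q_{11}y_1^2+q_{12}y_1y_2+w_1y_1+w_2y_2+w_0$ and $\{y,a\}=\alpha(a)y+\nu(a)$ for all $a,b\in R$ if and only if the following conditions (a)–(e) hold for all $a,b\in R$: (a) $\alpha(ab)=a\alpha(b)+b\alpha(a)$. (b) $\nu(ab)=a\nu(b)+b\nu(a)$. (c) $\alpha(\{a,b\})=\{\alpha(a),b\}+\{a,\alpha(b)\}+[\alpha(a),\alpha(b)]$. (d) $\nu(\{a,b\})=\{\nu(a),b\}+\{a,\nu(b)\}+\alpha(a)\nu(b)-\alpha(b)\nu(a)$. (e) $\{y_2,\{y_1,a\}\}+\{y_1,\{a,y_2\}\}+\{a,\{y_2,y_1\}\}=0$.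
   Context: ${\bf k}$ is a field of characteristic zero. A Poisson algebra is a commutative ${\bf k}$-algebra with a ${\bf k}$-bilinear bracket $\{-,-\}$ making it a Lie algebra and such that each $\{a,-\}$ is a derivation. In (8)–(13), $[\cdot,\cdot]$ is the commutator of ${\bf k}$-linear endomorphisms of $R$ under composition, and the equations are equalities of maps $R\to R$. In (c), $[\alpha(a),\alpha(b)]$ is the matrix commutator. Brackets of a matrix or column vector with an element are taken entrywise: $\{a,(b_{ij})\}=(\{a,b_{ij}\})$, $\{(b_{ij}),a\}=-\{a,(b_{ij})\}$, and similarly for columns; so $\{y,a\}=\begin{pmatrix} \{y_1,a\} \\ \{y_2,a\} \end{pmatrix}$. In (e), the bracket is computed in $R[y_1,y_2]$ with the skew-symmetric ${\bf k}$-bilinear bracket on $R[y_1,y_2]$ satisfying the Leibniz rule in each argument that is determined by the prescribed values $\{a,b\}=\{a,b\}_R$, $\{y_2,y_1\}$, $\{y,a\}$ (it exists when (a) and (b) hold). *)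

theory Defs
  imports "HOL-Analysis.Analysis" "HOL-Computational_Algebra.Polynomial"
begin

locale commutative_algebra = vector_space sc
  for sc :: "'k::field_char_0 \<Rightarrow> 'r::comm_ring_1 \<Rightarrow> 'r" +
  assumes scale_mult_left: "sc c (a * b) = sc c a * b"

definition derivation :: "('k::field_char_0 \<Rightarrow> 'r::comm_ring_1 \<Rightarrow> 'r) \<Rightarrow> ('r \<Rightarrow> 'r) \<Rightarrow> bool" where
  "derivation sc d \<longleftrightarrow>
     Vector_Spaces.linear sc sc d \<and> (\<forall>a b. d (a * b) = d a * b + a * d b)"

locale poisson_algebra = commutative_algebra sc
  for sc :: "'k::field_char_0 \<Rightarrow> 'r::comm_ring_1 \<Rightarrow> 'r" +
  fixes bracket :: "'r \<Rightarrow> 'r \<Rightarrow> 'r"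
  assumes linear_left: "Vector_Spaces.linear sc sc (\<lambda>a. bracket a b)"
    and derivation_right: "derivation sc (bracket a)"
    and alternating: "bracket a a = 0"
    and jacobi: "bracket a (bracket b c) + bracket b (bracket c a) + bracket c (bracket a b) = 0"

definition skew_biderivation ::
    "('k::field_char_0 \<Rightarrow> 'r::comm_ring_1 \<Rightarrow> 'r) \<Rightarrow> ('r \<Rightarrow> 'r \<Rightarrow> 'r) \<Rightarrow> bool" where
  "skew_biderivation sc B \<longleftrightarrow>
     (\<forall>a. derivation sc (\<lambda>b. B a b)) \<and> (\<forall>b. derivation sc (\<lambda>a. B a b)) \<and>
     (\<forall>a b. B a b = - B b a)"

definition commutator :: "('r::ab_group_add \<Rightarrow> 'r) \<Rightarrow> ('r \<Rightarrow> 'r) \<Rightarrow> 'r \<Rightarrow> 'r" where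
  "commutator f g = (\<lambda>a. f (g a) - g (f a))"

text \<open>Matrices are vectors of rows, so entrywise operations on a matrix are obtained by applying
  the following operations twice.\<close>

definition entrywise :: "('a \<Rightarrow> 'b) \<Rightarrow> 'a ^ 'n \<Rightarrow> 'b ^ 'n" where
  "entrywise f v = (\<chi> i. f (v $ i))"

definition vec_scale :: "('k \<Rightarrow> 'b \<Rightarrow> 'b) \<Rightarrow> 'k \<Rightarrow> 'b ^ 'n \<Rightarrow> 'b ^ 'n" where
  "vec_scale sc c = entrywise (sc c)"

definition bracket_elem_vec :: "('r \<Rightarrow> 'r \<Rightarrow> 'r) \<Rightarrow> 'r \<Rightarrow> 'r ^ 'n \<Rightarrow> 'r ^ 'n" where
  "bracket_elem_vec B a v = entrywise (B a) v"

definition bracket_vec_elem :: "('r::ab_group_add \<Rightarrow> 'r \<Rightarrow> 'r) \<Rightarrow> 'r ^ 'n \<Rightarrow> 'r \<Rightarrow> 'r ^ 'n" where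
  "bracket_vec_elem B v a = - bracket_elem_vec B a v"

definition bracket_elem_mat :: "('r \<Rightarrow> 'r \<Rightarrow> 'r) \<Rightarrow> 'r \<Rightarrow> 'r ^ 'n ^ 'm \<Rightarrow> 'r ^ 'n ^ 'm" where
  "bracket_elem_mat B a M = entrywise (entrywise (B a)) M"

definition bracket_mat_elem ::
    "('r::ab_group_add \<Rightarrow> 'r \<Rightarrow> 'r) \<Rightarrow> 'r ^ 'n ^ 'm \<Rightarrow> 'r \<Rightarrow> 'r ^ 'n ^ 'm" where
  "bracket_mat_elem B M a = - bracket_elem_mat B a M"

text \<open>The ring \<open>R[y\<^sub>1,y\<^sub>2]\<close> is represented as \<open>R[y\<^sub>1][y\<^sub>2]\<close>, i.e. as the type \<open>'r poly poly\<close>.\<close>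

definition const2 :: "'r::comm_ring_1 \<Rightarrow> 'r poly poly" where
  "const2 a = [:[:a:]:]"

definition Y1 :: "'r::comm_ring_1 poly poly" where
  "Y1 = [:[:0, 1:]:]"

definition Y2 :: "'r::comm_ring_1 poly poly" where
  "Y2 = [:0, 1:]"

definition Y :: "'r::comm_ring_1 poly poly ^ 2" where
  "Y = vector [Y1, Y2]"

definition scale2 :: "('k \<Rightarrow> 'r::comm_ring_1 \<Rightarrow> 'r) \<Rightarrow> 'k \<Rightarrow> 'r poly poly \<Rightarrow> 'r poly poly" where
  "scale2 sc c = map_poly (map_poly (sc c))"

definition prescribed_values ::
  "('k \<Rightarrow> 'r::comm_ring_1 \<Rightarrow> 'r) \<Rightarrow> ('r \<Rightarrow> 'r \<Rightarrow> 'r) \<Rightarrow> 'k \<Rightarrow> 'k \<Rightarrow> 'r \<Rightarrow> 'r \<Rightarrow> 'r \<Rightarrow>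
   ('r \<Rightarrow> 'r ^ 2 ^ 2) \<Rightarrow> ('r \<Rightarrow> 'r ^ 2) \<Rightarrow>
   ('r poly poly \<Rightarrow> 'r poly poly \<Rightarrow> 'r poly poly) \<Rightarrow> bool" where
  "prescribed_values sc pb q11 q12 w1 w2 w0 \<alpha> \<nu> B \<longleftrightarrow>
     (\<forall>a b. B (const2 a) (const2 b) = const2 (pb a b)) \<and>
     B Y2 Y1 = scale2 sc q11 (Y1\<^sup>2) + scale2 sc q12 (Y1 * Y2)
                 + const2 w1 * Y1 + const2 w2 * Y2 + const2 w0 \<and>
     (\<forall>a. bracket_vec_elem B Y (const2 a) =
            entrywise (entrywise const2) (\<alpha> a) *v Y + entrywise const2 (\<nu> a))"

text \<open>The description below determines a bracket if \<open>\<alpha>\<close> and \<open>\<nu>\<close> are \<open>k\<close>-linear and satisfy the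
  Leibniz rule; otherwise the value is unspecified.\<close>

definition extension_bracket ::
  "('k::field_char_0 \<Rightarrow> 'r::comm_ring_1 \<Rightarrow> 'r) \<Rightarrow> ('r \<Rightarrow> 'r \<Rightarrow> 'r) \<Rightarrow> 'k \<Rightarrow> 'k \<Rightarrow> 'r \<Rightarrow> 'r \<Rightarrow> 'r \<Rightarrow>
   ('r \<Rightarrow> 'r ^ 2 ^ 2) \<Rightarrow> ('r \<Rightarrow> 'r ^ 2) \<Rightarrow>
   'r poly poly \<Rightarrow> 'r poly poly \<Rightarrow> 'r poly poly" where
  "extension_bracket sc pb q11 q12 w1 w2 w0 \<alpha> \<nu> =
     (THE B. skew_biderivation (scale2 sc) B \<and>
             prescribed_values sc pb q11 q12 w1 w2 w0 \<alpha> \<nu> B)"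

end

theory Submission imports Defs begin

text \<open>A skew-symmetric biderivation of \<open>R[y\<^sub>1,y\<^sub>2]\<close> is determined by its values on the generators
  (\<open>R\<close>, \<open>y\<^sub>1\<close> and \<open>y\<^sub>2\<close>), and one with the prescribed values exists as soon as the \<open>\<alpha>\<^sub>i\<^sub>j\<close> and \<open>\<nu>\<^sub>i\<close> are
  derivations: it is a sum of skew-symmetrised products of coefficientwise extended derivations and
  formal partial derivatives. Its Jacobiator is a derivation in each argument, cyclic and alternating,
  so it vanishes iff it does on the triples \<open>(y\<^sub>1,a,b)\<close>, \<open>(y\<^sub>2,a,b)\<close> and \<open>(y\<^sub>2,y\<^sub>1,a)\<close>. Comparing
  coefficients of polynomials, these three cases are the conditions (2), (4), (6), then (3), (5), (7),
  and finally (8)-(13).\<close>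

section \<open>Derivations of commutative rings, with scalars left aside\<close>

definition ring_derivation :: "('a::comm_ring_1 \<Rightarrow> 'a) \<Rightarrow> bool" where
  "ring_derivation d \<longleftrightarrow>
     (\<forall>a b. d (a + b) = d a + d b) \<and> (\<forall>a b. d (a * b) = d a * b + a * d b)"

lemma ring_derivationI:
  assumes "\<And>a b. d (a + b) = d a + d b" "\<And>a b. d (a * b) = d a * b + a * d b"
  shows "ring_derivation d"
  using assms by (simp add: ring_derivation_def)

context
  fixes d :: "'a::comm_ring_1 \<Rightarrow> 'a"
  assumes d: "ring_derivation d"
begin

lemma ring_derivation_add: "d (a + b) = d a + d b"
  and ring_derivation_mult: "d (a * b) = d a * b + a * d b"
  using d by (auto simp: ring_derivation_def)

lemma ring_derivation_0: "d 0 = 0"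
  using ring_derivation_add[of 0 0] by simp

lemma ring_derivation_1: "d 1 = 0"
  using ring_derivation_mult[of 1 1] by simp

lemma ring_derivation_minus: "d (- a) = - d a"
  using ring_derivation_add[of a "- a"] by (simp add: ring_derivation_0 add_eq_0_iff)

lemma ring_derivation_diff_arg: "d (a - b) = d a - d b"
  using ring_derivation_add[of a "- b"] by (simp add: ring_derivation_minus)

end

lemma ring_derivation_plus:
  "ring_derivation d \<Longrightarrow> ring_derivation e \<Longrightarrow> ring_derivation (\<lambda>x. d x + e x)"
  by (simp add: ring_derivation_def algebra_simps)

lemma ring_derivation_diff:
  "ring_derivation d \<Longrightarrow> ring_derivation e \<Longrightarrow> ring_derivation (\<lambda>x. d x - e x)"
  by (simp add: ring_derivation_def algebra_simps)

lemma ring_derivation_cmult: "ring_derivation d \<Longrightarrow> ring_derivation (\<lambda>x. f * d x)"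
  by (simp add: ring_derivation_def algebra_simps)

lemma ring_derivation_multc: "ring_derivation d \<Longrightarrow> ring_derivation (\<lambda>x. d x * f)"
  by (simp add: ring_derivation_def algebra_simps)

text \<open>Coefficientwise application commutes with multiplication by the variable, so induction
  on the first factor reduces the Leibniz rule to a constant factor, which is the
  \<open>smult\<close> case.\<close>

lemma ring_derivation_map_poly:
  assumes d: "ring_derivation d"
  shows "ring_derivation (map_poly d)"
proof -
  have d0: "d 0 = 0" by (rule ring_derivation_0[OF d])
  have add: "map_poly d (p + q) = map_poly d p + map_poly d q" for p q
    by (rule poly_eqI) (simp add: coeff_map_poly d0 ring_derivation_add[OF d])
  have smult: "map_poly d (smult a q) = smult (d a) q + smult a (map_poly d q)" for a q
    by (rule poly_eqI) (simp add: coeff_map_poly d0 ring_derivation_mult[OF d])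
  show ?thesis
  proof (rule ring_derivationI, rule add)
    show "map_poly d (p * q) = map_poly d p * q + p * map_poly d q" for p q
      by (induction p) (simp_all add: map_poly_pCons d0 add smult algebra_simps)
  qed
qed

text \<open>The library's \<open>pderiv\<close> is confined to rings without zero divisors.\<close>

function formal_deriv :: "'a::comm_ring_1 poly \<Rightarrow> 'a poly" where
  "formal_deriv (pCons a p) = (if p = 0 then 0 else p + pCons 0 (formal_deriv p))"
  by (auto intro: pCons_cases)
termination by (relation "Wellfounded.measure degree") simp_all

declare formal_deriv.simps [simp del]

lemma formal_deriv_0 [simp]: "formal_deriv 0 = 0"
  using formal_deriv.simps[of 0 0] by simp

text \<open>The test \<open>p = 0\<close> in the recursion secures termination, since only a nonzero
  \<open>p\<close> has smaller degree than \<open>pCons a p\<close>. As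
  \<open>formal_deriv 0 = 0\<close>, the product rule for \<open>a + X * p\<close> holds in both
  cases.\<close>

lemma formal_deriv_pCons: "formal_deriv (pCons a p) = p + pCons 0 (formal_deriv p)"
  by (simp add: formal_deriv.simps)

lemma ring_derivation_formal_deriv: "ring_derivation formal_deriv"
proof -
  have add: "formal_deriv (p + q) = formal_deriv p + formal_deriv q" for p q :: "'a poly"
    by (induction p q rule: poly_induct2) (simp_all add: formal_deriv_pCons)
  have smult: "formal_deriv (smult a q) = smult a (formal_deriv q)" for a :: 'a and q
    by (induction q) (simp_all add: formal_deriv_pCons smult_add_right)
  show ?thesis
  proof (rule ring_derivationI, rule add)
    show "formal_deriv (p * q) = formal_deriv p * q + p * formal_deriv q" for p q :: "'a poly"
      by (induction p) (simp_all add: formal_deriv_pCons add smult algebra_simps)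
  qed
qed

section \<open>Skew-symmetric biderivations and their extension to polynomials\<close>

definition biderivation :: "('a::comm_ring_1 \<Rightarrow> 'a \<Rightarrow> 'a) \<Rightarrow> bool" where
  "biderivation B \<longleftrightarrow> (\<forall>a. ring_derivation (B a)) \<and> (\<forall>a b. B a b = - B b a)"

lemma biderivationI:
  assumes "\<And>a. ring_derivation (B a)" "\<And>a b. B a b = - B b a"
  shows "biderivation B"
  unfolding biderivation_def by (intro conjI allI assms)

lemma biderivationD:
  assumes "biderivation B"
  shows "ring_derivation (B a)" "B a b = - B b a"
  using assms unfolding biderivation_def by blast+

lemma biderivation_left:
  assumes "biderivation B"
  shows "ring_derivation (\<lambda>a. B a b)"
proof -
  have "(\<lambda>a. B a b) = (\<lambda>a. (- 1) * B b a)"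
    by (rule ext) (simp, rule biderivationD(2)[OF assms])
  then show ?thesis
    using ring_derivation_cmult[OF biderivationD(1)[OF assms], of "- 1" b] by simp
qed

text \<open>The extension of \<open>B\<close> to \<open>R[y]\<close> for which \<open>y\<close> is a Casimir element.\<close>

definition poly_bracket :: "('a::comm_ring_1 \<Rightarrow> 'a \<Rightarrow> 'a) \<Rightarrow> 'a poly \<Rightarrow> 'a poly \<Rightarrow> 'a poly" where
  "poly_bracket B p q = poly (map_poly (\<lambda>a. map_poly (B a) q) p) [:0, 1:]"

lemma biderivation_0:
  assumes "biderivation B"
  shows "B a 0 = 0" "B 0 a = 0"
  using ring_derivation_0[OF biderivationD(1)[OF assms]]
    ring_derivation_0[OF biderivation_left[OF assms]] by auto

lemma poly_bracket_0_left [simp]: "poly_bracket B 0 q = 0"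
  by (simp add: poly_bracket_def)

text \<open>Evaluation at the variable sums \<open>map_poly (B a) q\<close> over the coefficients
  \<open>a\<close> of \<open>p\<close>, each times its power of the variable. Splitting off the
  constant coefficient is a Horner step, and the facts below are derived through this
  recursion.\<close>

lemma poly_bracket_pCons_left:
  assumes "biderivation B"
  shows "poly_bracket B (pCons a p) q = map_poly (B a) q + pCons 0 (poly_bracket B p q)"
proof -
  have "map_poly (B 0) q = 0"
    by (rule poly_eqI) (simp add: coeff_map_poly biderivation_0[OF assms])
  then show ?thesis
    by (simp add: poly_bracket_def map_poly_pCons)
qed

lemma poly_bracket_const:
  assumes "biderivation B"
  shows "poly_bracket B [:a:] [:b:] = [:B a b:]"
  by (simp add: poly_bracket_pCons_left[OF assms] map_poly_pCons biderivation_0[OF assms])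

text \<open>The coefficients of the variable are 0 and 1, and every derivation kills both.\<close>

lemma poly_bracket_X:
  assumes "biderivation B"
  shows "poly_bracket B p [:0, 1:] = 0"
  by (induction p)
    (simp_all add: poly_bracket_pCons_left[OF assms] map_poly_pCons biderivation_0[OF assms]
      ring_derivation_1[OF biderivationD(1)[OF assms]])

lemma ring_derivation_poly_bracket:
  assumes B: "biderivation B"
  shows "ring_derivation (poly_bracket B p)"
proof (induction p)
  case 0
  then show ?case by (simp add: ring_derivation_def)
next
  case (pCons a p)
  have "poly_bracket B (pCons a p) = (\<lambda>q. map_poly (B a) q + [:0, 1:] * poly_bracket B p q)"
    by (auto simp: poly_bracket_pCons_left[OF B])
  then show ?case
    using ring_derivation_plus[OF ring_derivation_map_poly[OF biderivationD(1)[OF B]]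
        ring_derivation_cmult[OF pCons.IH, of "[:0, 1:]"]] by simp
qed

text \<open>The defining formula treats its arguments differently, so an induction is needed:
  \<open>pCons a p\<close> is a constant plus the variable times \<open>p\<close>, and the Leibniz
  rule in the second argument moves the Casimir variable out of the bracket.\<close>

lemma poly_bracket_skew:
  assumes B: "biderivation B"
  shows "poly_bracket B p q = - poly_bracket B q p"
proof (induction p arbitrary: q)
  case 0
  then show ?case
    by (simp add: ring_derivation_0[OF ring_derivation_poly_bracket[OF B]])
next
  case (pCons a p)
  note D = ring_derivation_poly_bracket[OF B]
  \<comment> \<open>For a constant second argument the claim reduces to skew-symmetry of
    \<open>B\<close> on the coefficients of \<open>q\<close>.\<close>
  have const: "poly_bracket B q [:a:] = - map_poly (B a) q" for q
  proof (induction q)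
    case 0
    then show ?case by simp
  next
    case (pCons b q)
    then show ?case
      by (simp add: poly_bracket_pCons_left[OF B] map_poly_pCons biderivation_0[OF B]
          biderivationD(2)[OF B, of b a])
  qed
  have "pCons a p = [:a:] + [:0, 1:] * p" by simp
  then have "poly_bracket B q (pCons a p) =
      poly_bracket B q [:a:] + poly_bracket B q ([:0, 1:] * p)"
    by (simp only: ring_derivation_add[OF D])
  also have "\<dots> = - map_poly (B a) q + [:0, 1:] * poly_bracket B q p"
    by (simp only: ring_derivation_mult[OF D] poly_bracket_X[OF B] const) simp
  finally show ?case
    by (simp add: poly_bracket_pCons_left[OF B] pCons.IH[of q])
qed

lemma biderivation_poly_bracket:
  "biderivation B \<Longrightarrow> biderivation (poly_bracket B)"
  by (rule biderivationI[OF ring_derivation_poly_bracket poly_bracket_skew])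

section \<open>The Jacobiator of a biderivation\<close>

definition jacobiator :: "('a::comm_ring_1 \<Rightarrow> 'a \<Rightarrow> 'a) \<Rightarrow> 'a \<Rightarrow> 'a \<Rightarrow> 'a \<Rightarrow> 'a" where
  "jacobiator B x y z = B x (B y z) + B y (B z x) + B z (B x y)"

lemma jacobiator_cyclic: "jacobiator B x y z = jacobiator B y z x"
  by (simp add: jacobiator_def algebra_simps)

lemma biderivation_simps:
  assumes "biderivation B"
  shows "B x (y + z) = B x y + B x z" "B (x + y) z = B x z + B y z"
    "B x (y * z) = B x y * z + y * B x z" "B (x * y) z = B x z * y + x * B y z"
    "B x (- y) = - B x y" "B (- x) y = - B x y"
    "B x (y - z) = B x y - B x z" "B (x - y) z = B x z - B y z"
  using ring_derivation_add[OF biderivationD(1)[OF assms]]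
    ring_derivation_add[OF biderivation_left[OF assms]]
    ring_derivation_mult[OF biderivationD(1)[OF assms]]
    ring_derivation_mult[OF biderivation_left[OF assms]]
    ring_derivation_minus[OF biderivationD(1)[OF assms]]
    ring_derivation_minus[OF biderivation_left[OF assms]]
    ring_derivation_diff_arg[OF biderivationD(1)[OF assms]]
    ring_derivation_diff_arg[OF biderivation_left[OF assms]]
  by (simp_all add: algebra_simps)

text \<open>Together with \<open>jacobiator_cyclic\<close> this covers all orderings of three
  arguments.\<close>

lemma jacobiator_swap:
  assumes "biderivation B"
  shows "jacobiator B x z y = - jacobiator B x y z"
  using biderivationD(2)[OF assms, of z y] biderivationD(2)[OF assms, of y x]
    biderivationD(2)[OF assms, of x z]
  by (simp add: jacobiator_def biderivation_simps[OF assms])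

text \<open>Applying the Leibniz rule twice produces the cross terms \<open>B y a * B z b\<close>
  and \<open>B z a * B y b\<close>. Each occurs once with either sign in the cyclic sum, by
  skew-symmetry, and cancels.\<close>

lemma ring_derivation_jacobiator:
  assumes "biderivation B"
  shows "ring_derivation (\<lambda>x. jacobiator B x y z)"
proof (rule ring_derivationI)
  show "jacobiator B (a + b) y z = jacobiator B a y z + jacobiator B b y z" for a b
    by (simp add: jacobiator_def biderivation_simps[OF assms])
  show "jacobiator B (a * b) y z = jacobiator B a y z * b + a * jacobiator B b y z" for a b
    using biderivationD(2)[OF assms, of z a] biderivationD(2)[OF assms, of z b]
      biderivationD(2)[OF assms, of y a] biderivationD(2)[OF assms, of y b]
    by (simp add: jacobiator_def biderivation_simps[OF assms] algebra_simps)
qed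

section \<open>Induction over the generators of R[y1,y2]\<close>

lemma poly_poly_induct [case_names const Y1 Y2 add mult]:
  assumes const: "\<And>a. P (const2 a)" and Y1: "P Y1" and Y2: "P Y2"
    and add: "\<And>p q. P p \<Longrightarrow> P q \<Longrightarrow> P (p + q)"
    and mult: "\<And>p q. P p \<Longrightarrow> P q \<Longrightarrow> P (p * q)"
  shows "P p"
proof (induction p)
  case 0
  show ?case using const[of 0] by (simp add: const2_def)
next
  case (pCons a p)
  have "P [:a:]"
  proof (induction a)
    case 0
    show ?case using const[of 0] by (simp add: const2_def)
  next
    case (pCons c a)
    have "P (const2 c + Y1 * [:a:])"
      by (intro add mult const Y1 pCons.IH)
    then show ?case by (simp add: const2_def Y1_def)
  qed
  then have "P ([:a:] + Y2 * p)"
    by (intro add mult Y2 pCons.IH)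
  then show ?case by (simp add: Y2_def)
qed

text \<open>The elements on which two derivations agree are closed under sums and products, so
  generators suffice.\<close>

lemma ring_derivation_eqI:
  assumes d: "ring_derivation d" and e: "ring_derivation e"
    and gen: "\<And>a. d (const2 a) = e (const2 a)" "d Y1 = e Y1" "d Y2 = e Y2"
  shows "d = e"
proof
  fix p
  show "d p = e p"
    by (induction p rule: poly_poly_induct)
      (simp_all add: gen ring_derivation_add[OF d] ring_derivation_add[OF e]
        ring_derivation_mult[OF d] ring_derivation_mult[OF e])
qed

section \<open>Derivations, biderivations and Poisson brackets over k\<close>

lemma (in commutative_algebra) scale_eq_mult: "sc c a = sc c 1 * a"
  using scale_mult_left[of c 1 a] by simp

text \<open>Over a \<open>k\<close>-algebra, \<open>k\<close>-linearity of a derivation only has to be checked on scalars.\<close>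

lemma derivation_iff:
  fixes sc :: "'k::field_char_0 \<Rightarrow> 'a::comm_ring_1 \<Rightarrow> 'a"
  assumes "commutative_algebra sc"
  shows "derivation sc d \<longleftrightarrow> ring_derivation d \<and> (\<forall>c. d (sc c 1) = 0)"
proof -
  interpret commutative_algebra sc by fact
  show ?thesis
  proof
    assume d: "derivation sc d"
    then have rd: "ring_derivation d"
      by (simp add: derivation_def Vector_Spaces.linear_iff ring_derivation_def)
    from d have "d (sc c 1) = sc c (d 1)" for c
      by (simp add: derivation_def Vector_Spaces.linear_iff)
    with rd show "ring_derivation d \<and> (\<forall>c. d (sc c 1) = 0)"
      by (simp add: ring_derivation_1)
  next
    assume d: "ring_derivation d \<and> (\<forall>c. d (sc c 1) = 0)"
    then have "d (sc c a) = sc c (d a)" for c a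
      by (subst (1 2) scale_eq_mult) (simp add: ring_derivation_mult)
    with d show "derivation sc d"
      by (auto simp: derivation_def Vector_Spaces.linear_iff vector_space_axioms ring_derivation_def)
  qed
qed

text \<open>Skew-symmetry transfers the derivation property to the left argument, and by
  \<open>derivation_iff\<close> linearity amounts to killing the scalars
  \<open>sc c 1\<close>.\<close>

lemma skew_biderivation_iff:
  fixes sc :: "'k::field_char_0 \<Rightarrow> 'a::comm_ring_1 \<Rightarrow> 'a"
  assumes "commutative_algebra sc"
  shows "skew_biderivation sc B \<longleftrightarrow> biderivation B \<and> (\<forall>a c. B a (sc c 1) = 0)"
proof
  assume B: "biderivation B \<and> (\<forall>a c. B a (sc c 1) = 0)"
  then have "B (sc c 1) a = 0" for c a
    by (metis biderivationD(2) minus_zero)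
  with B show "skew_biderivation sc B"
    unfolding skew_biderivation_def derivation_iff[OF assms]
    by (blast intro: biderivationD biderivation_left)
qed (unfold skew_biderivation_def derivation_iff[OF assms], blast intro: biderivationI)

text \<open>Skew-symmetry only gives twice \<open>B a a = 0\<close>. Writing the factor 2 as a
  scalar of the field, where it is invertible by characteristic zero, allows it to be
  cancelled.\<close>

lemma skew_biderivation_self:
  fixes sc :: "'k::field_char_0 \<Rightarrow> 'a::comm_ring_1 \<Rightarrow> 'a"
  assumes "commutative_algebra sc" "skew_biderivation sc B"
  shows "B a a = 0"
proof -
  interpret commutative_algebra sc by fact
  have "B a a = - B a a"
    using assms unfolding skew_biderivation_def by blast
  then have "B a a + B a a = 0"
    by (rule eq_neg_iff_add_eq_0[THEN iffD1])
  then have "sc (1 + 1) (B a a) = 0"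
    by (simp only: scale_left_distrib scale_one)
  then show ?thesis by simp
qed

text \<open>Isolates the Jacobi identity as the one condition to test on a skew biderivation.
  Skew-symmetry follows from the alternating law by expanding \<open>B (a + b) (a + b)\<close>; the
  way back is \<open>skew_biderivation_self\<close>.\<close>

lemma poisson_algebra_iff:
  fixes sc :: "'k::field_char_0 \<Rightarrow> 'a::comm_ring_1 \<Rightarrow> 'a"
  shows "poisson_algebra sc B \<longleftrightarrow>
    commutative_algebra sc \<and> skew_biderivation sc B \<and> (\<forall>x y z. jacobiator B x y z = 0)"
proof
  assume "poisson_algebra sc B"
  then interpret poisson_algebra sc B .
  have skew: "B a b = - B b a" for a b
  proof -
    have "B (a + b) (a + b) = B a a + B a b + (B b a + B b b)"
      using derivation_right[of "a + b"] linear_left[of a] linear_left[of b]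
      by (simp add: derivation_def Vector_Spaces.linear_iff algebra_simps)
    then show ?thesis
      by (simp add: alternating eq_neg_iff_add_eq_0)
  qed
  have "biderivation B"
    using derivation_right by (intro biderivationI skew) (simp add: derivation_iff[OF commutative_algebra_axioms])
  then have "skew_biderivation sc B"
    using derivation_right
    by (simp add: skew_biderivation_iff[OF commutative_algebra_axioms] derivation_iff[OF commutative_algebra_axioms])
  with jacobi show "commutative_algebra sc \<and> skew_biderivation sc B \<and> (\<forall>x y z. jacobiator B x y z = 0)"
    by (simp add: jacobiator_def commutative_algebra_axioms)
next
  assume *: "commutative_algebra sc \<and> skew_biderivation sc B \<and> (\<forall>x y z. jacobiator B x y z = 0)"
  then interpret commutative_algebra sc by blast
  have "B a a = 0" for a
    using * by (blast intro: skew_biderivation_self)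
  moreover have "derivation sc (\<lambda>b. B a b)" "derivation sc (\<lambda>a. B a b)" for a b
    using * unfolding skew_biderivation_def by blast+
  moreover have "jacobiator B x y z = 0" for x y z
    using * by blast
  ultimately show "poisson_algebra sc B"
    by unfold_locales (simp_all add: derivation_def jacobiator_def Vector_Spaces.linear_iff)
qed

section \<open>Constants, scalars and comparison of coefficients in R[y1,y2]\<close>

lemma const2_hom:
  "const2 (a + b) = const2 a + const2 b" "const2 (a - b) = const2 a - const2 b"
  "const2 (a * b) = const2 a * const2 b" "const2 (- a) = - const2 a" "const2 0 = 0" "const2 1 = 1"
  "const2 (numeral n) = numeral n"
  by (simp_all add: const2_def one_pCons numeral_poly)

lemma const2_linear_eq_0_iff:
  "const2 a * Y1 + const2 b * Y2 + const2 c = 0 \<longleftrightarrow> a = 0 \<and> b = 0 \<and> c = 0"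
  by (auto simp: const2_def Y1_def Y2_def)

lemma const2_linear_eq_iff:
  "const2 a * Y1 + const2 b * Y2 + const2 c = const2 a' * Y1 + const2 b' * Y2 + const2 c'
    \<longleftrightarrow> a = a' \<and> b = b' \<and> c = c'"
  by (auto simp: const2_def Y1_def Y2_def)

text \<open>Quadratic polynomials occur because the bracket of \<open>Y2\<close> and
  \<open>Y1\<close> has degree two.\<close>

lemma const2_quadratic_eq_0_iff:
  "const2 a * Y1\<^sup>2 + const2 b * (Y1 * Y2) + const2 c * Y2\<^sup>2
      + const2 d * Y1 + const2 e * Y2 + const2 f = 0
    \<longleftrightarrow> a = 0 \<and> b = 0 \<and> c = 0 \<and> d = 0 \<and> e = 0 \<and> f = 0"
  by (auto simp: const2_def Y1_def Y2_def power2_eq_square)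

context commutative_algebra
begin

text \<open>Turns scaling into multiplication by a constant polynomial, so that scalars are handled
  by ring arithmetic alone.\<close>

lemma scale2_eq_mult: "scale2 sc c p = const2 (sc c 1) * p"
proof -
  have "map_poly (sc c) = smult (sc c 1)"
    by (intro ext poly_eqI) (simp add: coeff_map_poly scale_eq_mult[of c "coeff _ _"])
  then have "scale2 sc c p = map_poly (smult (sc c 1)) p"
    by (simp add: scale2_def)
  also have "\<dots> = const2 (sc c 1) * p"
    by (rule poly_eqI) (simp add: coeff_map_poly const2_def)
  finally show ?thesis .
qed

lemma scale2_1: "scale2 sc c 1 = const2 (sc c 1)"
  by (simp add: scale2_eq_mult)

lemma scale_1_mult: "sc (c * d) 1 = sc c 1 * sc d 1"
  by (metis scale_eq_mult scale_scale)

lemma commutative_algebra_scale2: "commutative_algebra (scale2 sc)"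
  by unfold_locales
    (simp_all add: scale2_eq_mult algebra_simps const2_hom scale_left_distrib scale_1_mult)

end

section \<open>Coefficientwise and partial derivations of R[y1,y2]\<close>

abbreviation coeffwise :: "('r::comm_ring_1 \<Rightarrow> 'r) \<Rightarrow> 'r poly poly \<Rightarrow> 'r poly poly" where
  "coeffwise d \<equiv> map_poly (map_poly d)"

lemma coeffwise_simps:
  assumes "ring_derivation d"
  shows "coeffwise d (const2 a) = const2 (d a)" "coeffwise d Y1 = 0" "coeffwise d Y2 = 0"
  using ring_derivation_0[OF assms] ring_derivation_1[OF assms]
  by (simp_all add: const2_def Y1_def Y2_def map_poly_pCons map_poly_1)

text \<open>In R[y1][y2] the variable y1 is the inner one, so its partial derivative acts on the
  coefficients; that of the outer variable y2 is \<open>formal_deriv\<close> itself.\<close>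

abbreviation dY1 :: "'r::comm_ring_1 poly poly \<Rightarrow> 'r poly poly" where
  "dY1 \<equiv> map_poly formal_deriv"

abbreviation dY2 :: "'r::comm_ring_1 poly poly \<Rightarrow> 'r poly poly" where
  "dY2 \<equiv> formal_deriv"

lemma dY_simps:
  "dY1 (const2 a) = 0" "dY1 Y1 = 1" "dY1 Y2 = 0"
  "dY2 (const2 a) = 0" "dY2 Y1 = 0" "dY2 Y2 = 1"
  by (simp_all add: const2_def Y1_def Y2_def map_poly_pCons formal_deriv_pCons one_pCons)

section \<open>The data and the conditions in components\<close>

locale generator_data = poisson_algebra sc pb
  for sc :: "'k::field_char_0 \<Rightarrow> 'r::comm_ring_1 \<Rightarrow> 'r" and pb +
  fixes q11 q12 :: 'k and w1 w2 w0 :: 'r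
    and \<alpha>11 \<alpha>12 \<alpha>21 \<alpha>22 \<nu>1 \<nu>2 :: "'r \<Rightarrow> 'r"
begin

text \<open>The componentwise counterpart of \<open>prescribed_values\<close>;
  \<open>prescribed_values_iff\<close> links the two.\<close>

definition generator_values :: "('r poly poly \<Rightarrow> 'r poly poly \<Rightarrow> 'r poly poly) \<Rightarrow> bool" where
  "generator_values B \<longleftrightarrow>
     (\<forall>a b. B (const2 a) (const2 b) = const2 (pb a b)) \<and>
     B Y2 Y1 = scale2 sc q11 (Y1\<^sup>2) + scale2 sc q12 (Y1 * Y2)
                 + const2 w1 * Y1 + const2 w2 * Y2 + const2 w0 \<and>
     (\<forall>a. B Y1 (const2 a) = const2 (\<alpha>11 a) * Y1 + const2 (\<alpha>12 a) * Y2 + const2 (\<nu>1 a)) \<and>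
     (\<forall>a. B Y2 (const2 a) = const2 (\<alpha>21 a) * Y1 + const2 (\<alpha>22 a) * Y2 + const2 (\<nu>2 a))"

definition derivation_cond :: bool where
  "derivation_cond \<longleftrightarrow> derivation sc \<alpha>11 \<and> derivation sc \<alpha>12 \<and> derivation sc \<alpha>21 \<and>
     derivation sc \<alpha>22 \<and> derivation sc \<nu>1 \<and> derivation sc \<nu>2"

text \<open>The equations are grouped by generator: they are the coefficients of \<open>Y1\<close>,
  \<open>Y2\<close> and 1 in the Jacobi identity for \<open>Y1\<close>, \<open>const2 a\<close>,
  \<open>const2 b\<close>.\<close>

definition compat_Y1 :: "'r \<Rightarrow> 'r \<Rightarrow> bool" where
  "compat_Y1 a b \<longleftrightarrow>
      \<alpha>11 (pb a b) - pb (\<alpha>11 a) b - pb a (\<alpha>11 b) = \<alpha>12 a * \<alpha>21 b - \<alpha>21 a * \<alpha>12 b \<and>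
      \<alpha>12 (pb a b) - pb (\<alpha>12 a) b - pb a (\<alpha>12 b) =
         \<alpha>11 a * \<alpha>12 b - \<alpha>12 a * \<alpha>11 b + \<alpha>12 a * \<alpha>22 b - \<alpha>22 a * \<alpha>12 b \<and>
      \<nu>1 (pb a b) - pb (\<nu>1 a) b - pb a (\<nu>1 b) =
         \<alpha>11 a * \<nu>1 b - \<nu>1 a * \<alpha>11 b + \<alpha>12 a * \<nu>2 b - \<nu>2 a * \<alpha>12 b"

definition compat_Y2 :: "'r \<Rightarrow> 'r \<Rightarrow> bool" where
  "compat_Y2 a b \<longleftrightarrow>
      \<alpha>21 (pb a b) - pb (\<alpha>21 a) b - pb a (\<alpha>21 b) =
         \<alpha>21 a * \<alpha>11 b - \<alpha>11 a * \<alpha>21 b + \<alpha>22 a * \<alpha>21 b - \<alpha>21 a * \<alpha>22 b \<and>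
      \<alpha>22 (pb a b) - pb (\<alpha>22 a) b - pb a (\<alpha>22 b) = \<alpha>21 a * \<alpha>12 b - \<alpha>12 a * \<alpha>21 b \<and>
      \<nu>2 (pb a b) - pb (\<nu>2 a) b - pb a (\<nu>2 b) =
         \<alpha>21 a * \<nu>1 b - \<nu>1 a * \<alpha>21 b + \<alpha>22 a * \<nu>2 b - \<nu>2 a * \<alpha>22 b"

text \<open>In this order, the equations come from the coefficients of \<open>Y1\<^sup>2\<close>,
  \<open>Y1 * Y2\<close>, \<open>Y2\<^sup>2\<close>, \<open>Y1\<close>, \<open>Y2\<close> and 1 in
  the Jacobi identity for \<open>Y2\<close>, \<open>Y1\<close>, \<open>const2 a\<close>.\<close>

definition commutator_cond :: "'r \<Rightarrow> bool" where
  "commutator_cond a \<longleftrightarrow>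
      commutator \<alpha>21 \<alpha>11 a = sc q11 (\<alpha>11 a) + sc q12 (\<alpha>21 a) - sc q11 (\<alpha>22 a) \<and>
      commutator \<alpha>22 \<alpha>11 a + commutator \<alpha>21 \<alpha>12 a = sc (2 * q11) (\<alpha>12 a) \<and>
      commutator \<alpha>22 \<alpha>12 a = sc q12 (\<alpha>12 a) \<and>
      commutator \<nu>2 \<alpha>11 a + commutator \<alpha>21 \<nu>1 a =
        sc (2 * q11) (\<nu>1 a) + sc q12 (\<nu>2 a) + w2 * \<alpha>21 a - w1 * \<alpha>22 a + pb w1 a \<and>
      commutator \<nu>2 \<alpha>12 a + commutator \<alpha>22 \<nu>1 a =
        sc q12 (\<nu>1 a) + w1 * \<alpha>12 a - w2 * \<alpha>11 a + pb w2 a \<and>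
      commutator \<nu>2 \<nu>1 a = w1 * \<nu>1 a + w2 * \<nu>2 a - w0 * \<alpha>11 a - w0 * \<alpha>22 a + pb w0 a"

section \<open>Existence and uniqueness of the extended bracket\<close>

lemma skew_biderivation_pb: "skew_biderivation sc pb"
  using poisson_algebra_iff[of sc pb] poisson_algebra_axioms by simp

lemma biderivation_pb: "biderivation pb"
  using skew_biderivation_pb by (simp add: skew_biderivation_iff[OF commutative_algebra_axioms])

text \<open>Skew-symmetrised products of derivations are biderivations, and the four summands take the
  prescribed values on \<open>R \<times> R\<close>, \<open>{y\<^sub>1} \<times> R\<close>, \<open>{y\<^sub>2} \<times> R\<close> and \<open>(y\<^sub>2, y\<^sub>1)\<close> respectively.\<close>

definition ext_bracket :: "'r poly poly \<Rightarrow> 'r poly poly \<Rightarrow> 'r poly poly" where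
  "ext_bracket p q = (let
      D1 = (\<lambda>p. coeffwise \<alpha>11 p * Y1 + coeffwise \<alpha>12 p * Y2 + coeffwise \<nu>1 p);
      D2 = (\<lambda>p. coeffwise \<alpha>21 p * Y1 + coeffwise \<alpha>22 p * Y2 + coeffwise \<nu>2 p)
    in poly_bracket (poly_bracket pb) p q
      + (dY1 p * D1 q - D1 p * dY1 q) + (dY2 p * D2 q - D2 p * dY2 q)
      + (scale2 sc q11 (Y1\<^sup>2) + scale2 sc q12 (Y1 * Y2) + const2 w1 * Y1 + const2 w2 * Y2 + const2 w0)
        * (dY2 p * dY1 q - dY1 p * dY2 q))"

text \<open>Under \<open>derivation_cond\<close> the maps \<open>D1\<close> and \<open>D2\<close>
  are derivations that kill both variables, while the partial derivatives kill constants. Hence on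
  each pair of generators only the intended summand survives.\<close>

lemma
  assumes "derivation_cond"
  shows skew_biderivation_ext_bracket: "skew_biderivation (scale2 sc) ext_bracket"
    and generator_values_ext_bracket: "generator_values ext_bracket"
proof -
  let ?PB = "poly_bracket (poly_bracket pb)"
  let ?D1 = "\<lambda>p. coeffwise \<alpha>11 p * Y1 + coeffwise \<alpha>12 p * Y2 + coeffwise \<nu>1 p"
  let ?D2 = "\<lambda>p. coeffwise \<alpha>21 p * Y1 + coeffwise \<alpha>22 p * Y2 + coeffwise \<nu>2 p"
  note der = assms[unfolded derivation_cond_def derivation_iff[OF commutative_algebra_axioms]]
  have pb1: "biderivation (poly_bracket pb)" and PB: "biderivation ?PB"
    by (intro biderivation_poly_bracket biderivation_pb)+
  have D: "ring_derivation ?D1" "ring_derivation ?D2"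
    using der by (auto intro!: ring_derivation_plus ring_derivation_multc ring_derivation_map_poly)
  have d1: "ring_derivation dY1" and d2: "ring_derivation dY2"
    by (intro ring_derivation_map_poly ring_derivation_formal_deriv)+
  have "ring_derivation (ext_bracket p)" for p
    unfolding ext_bracket_def Let_def
    by (intro ring_derivation_plus ring_derivation_diff ring_derivation_cmult biderivationD(1)[OF PB]
        D d1 d2)
  moreover have "ext_bracket p q = - ext_bracket q p" for p q
    unfolding ext_bracket_def Let_def
    by (subst biderivationD(2)[OF PB]) (simp add: algebra_simps)
  ultimately have B: "biderivation ext_bracket"
    by (rule biderivationI)
  have PB_simps: "?PB (const2 a) (const2 b) = const2 (pb a b)" "?PB p Y1 = 0" "?PB p Y2 = 0"
      "?PB Y1 p = 0" "?PB Y2 p = 0" for a b p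
  proof -
    show "?PB (const2 a) (const2 b) = const2 (pb a b)"
      by (simp add: const2_def poly_bracket_const[OF pb1] poly_bracket_const[OF biderivation_pb])
    \<comment> \<open>\<open>Y1\<close> is a constant over the inner ring R[y1], and its coefficient
      is a Casimir element of \<open>poly_bracket pb\<close>.\<close>
    have "map_poly (poly_bracket pb x) [:[:0, 1:]:] = 0" for x
      by (simp add: map_poly_pCons biderivation_0[OF pb1] poly_bracket_X[OF biderivation_pb])
    then show Y1: "?PB p Y1 = 0" for p
      by (induction p) (simp_all add: Y1_def poly_bracket_pCons_left[OF pb1])
    show Y2: "?PB p Y2 = 0" for p
      unfolding Y2_def by (rule poly_bracket_X[OF pb1])
    show "?PB Y1 p = 0" "?PB Y2 p = 0"
      using Y1 Y2 biderivationD(2)[OF PB, of Y1 p] biderivationD(2)[OF PB, of Y2 p] by simp_all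
  qed
  have D_simps: "?D1 (const2 a) = const2 (\<alpha>11 a) * Y1 + const2 (\<alpha>12 a) * Y2 + const2 (\<nu>1 a)"
      "?D2 (const2 a) = const2 (\<alpha>21 a) * Y1 + const2 (\<alpha>22 a) * Y2 + const2 (\<nu>2 a)"
      "?D1 Y1 = 0" "?D1 Y2 = 0" "?D2 Y1 = 0" "?D2 Y2 = 0" for a
    using der by (simp_all add: coeffwise_simps)
  show "generator_values ext_bracket"
    unfolding generator_values_def ext_bracket_def Let_def D_simps PB_simps dY_simps by simp
  \<comment> \<open>This is the linearity over k. The bracket with a fixed scalar is a derivation in
    \<open>p\<close>, so it vanishes once it does on generators.\<close>
  have "ext_bracket p (const2 (sc c 1)) = 0" for p c
  proof -
    have "pb a (sc c 1) = 0" for a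
      using skew_biderivation_pb by (simp add: skew_biderivation_iff[OF commutative_algebra_axioms])
    then have "ext_bracket (const2 a) (const2 (sc c 1)) = 0" for a
      unfolding ext_bracket_def Let_def D_simps PB_simps dY_simps by (simp add: const2_hom)
    moreover have "ext_bracket Y1 (const2 (sc c 1)) = 0" "ext_bracket Y2 (const2 (sc c 1)) = 0"
      unfolding ext_bracket_def Let_def D_simps PB_simps dY_simps using der by (simp_all add: const2_hom)
    ultimately have "(\<lambda>p. ext_bracket p (const2 (sc c 1))) = (\<lambda>p. 0)"
      by (intro ring_derivation_eqI biderivation_left[OF B]) (auto simp: ring_derivation_def)
    then show ?thesis by meson
  qed
  with B show "skew_biderivation (scale2 sc) ext_bracket"
    by (simp add: skew_biderivation_iff[OF commutative_algebra_scale2] scale2_1)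
qed

text \<open>Agreement on pairs of generators is extended first to all second arguments and then to
  all first arguments, each time because a derivation is determined on generators.\<close>

lemma generator_values_unique:
  assumes "skew_biderivation (scale2 sc) B" "generator_values B"
    and "skew_biderivation (scale2 sc) B'" "generator_values B'"
  shows "B = B'"
proof -
  have bi: "biderivation B" "biderivation B'"
    using assms by (auto simp: skew_biderivation_iff[OF commutative_algebra_scale2])
  have skew: "B (const2 a) Y1 = - B Y1 (const2 a)" "B (const2 a) Y2 = - B Y2 (const2 a)"
    "B' (const2 a) Y1 = - B' Y1 (const2 a)" "B' (const2 a) Y2 = - B' Y2 (const2 a)"
    "B Y1 Y2 = - B Y2 Y1" "B' Y1 Y2 = - B' Y2 Y1" for a
    using bi by (auto dest: biderivationD(2))
  \<comment> \<open>The prescribed values leave out the pairs \<open>(Y1, Y1)\<close> and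
    \<open>(Y2, Y2)\<close>, on which any skew biderivation vanishes.\<close>
  have diag: "C x x = 0" if "skew_biderivation (scale2 sc) C" for C x
    by (rule skew_biderivation_self[OF commutative_algebra_scale2 that])
  have gen: "B x (const2 a) = B' x (const2 a)" "B x Y1 = B' x Y1" "B x Y2 = B' x Y2" 
    if "x \<in> insert Y1 (insert Y2 (range const2))" for x a
    using that assms diag[OF assms(1)] diag[OF assms(3)]
    by (auto simp: generator_values_def skew)
  have "B x = B' x" if "x \<in> insert Y1 (insert Y2 (range const2))" for x
    by (intro ring_derivation_eqI biderivationD(1) bi gen that)
  then have "(\<lambda>x. B x y) = (\<lambda>x. B' x y)" for y
    by (intro ring_derivation_eqI biderivation_left bi) (auto dest!: fun_cong)
  then show ?thesis by (meson ext)
qed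

section \<open>The Jacobi identity for a bracket with the given generator values\<close>

context
  fixes B :: "'r poly poly \<Rightarrow> 'r poly poly \<Rightarrow> 'r poly poly"
  assumes skew_B: "skew_biderivation (scale2 sc) B" and values_B: "generator_values B"
begin

lemma biderivation_B: "biderivation B"
  using skew_B by (simp add: skew_biderivation_iff[OF commutative_algebra_scale2])

lemma B_generators:
  "B (const2 a) (const2 b) = const2 (pb a b)"
  "B Y1 (const2 a) = const2 (\<alpha>11 a) * Y1 + const2 (\<alpha>12 a) * Y2 + const2 (\<nu>1 a)"
  "B Y2 (const2 a) = const2 (\<alpha>21 a) * Y1 + const2 (\<alpha>22 a) * Y2 + const2 (\<nu>2 a)"
  "B (const2 a) Y1 = - (const2 (\<alpha>11 a) * Y1 + const2 (\<alpha>12 a) * Y2 + const2 (\<nu>1 a))"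
  "B (const2 a) Y2 = - (const2 (\<alpha>21 a) * Y1 + const2 (\<alpha>22 a) * Y2 + const2 (\<nu>2 a))"
  "B Y2 Y1 = const2 (sc q11 1) * (Y1 * Y1) + const2 (sc q12 1) * (Y1 * Y2)
               + const2 w1 * Y1 + const2 w2 * Y2 + const2 w0"
  "B Y1 Y2 = - (const2 (sc q11 1) * (Y1 * Y1) + const2 (sc q12 1) * (Y1 * Y2)
               + const2 w1 * Y1 + const2 w2 * Y2 + const2 w0)"
  using values_B biderivationD(2)[OF biderivation_B, of "const2 a" Y1]
    biderivationD(2)[OF biderivation_B, of Y1 Y2]
    biderivationD(2)[OF biderivation_B, of "const2 a" Y2]
  by (auto simp: generator_values_def scale2_eq_mult power2_eq_square)

lemma B_self: "B x x = 0"
  by (rule skew_biderivation_self[OF commutative_algebra_scale2 skew_B])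

lemma B_scalar: "B x (const2 (sc c 1)) = 0"
  using skew_B by (simp add: skew_biderivation_iff[OF commutative_algebra_scale2] scale2_1)

lemma jacobiator_const: "jacobiator B (const2 a) (const2 b) (const2 c) = 0"
  using jacobi[of a b c]
  by (simp add: jacobiator_def B_generators const2_hom(5)[symmetric] flip: const2_hom(1))

text \<open>Expanding by the Leibniz rule leaves a polynomial of degree at most one in the
  variables, whose coefficients are the differences of the two sides in
  \<open>compat_Y1\<close>.\<close>

lemma jacobiator_Y1_const_const: "jacobiator B Y1 (const2 a) (const2 b) = 0 \<longleftrightarrow> compat_Y1 a b"
proof -
  have "jacobiator B Y1 (const2 a) (const2 b) =
      const2 (\<alpha>11 (pb a b) - pb (\<alpha>11 a) b - pb a (\<alpha>11 b) - (\<alpha>12 a * \<alpha>21 b - \<alpha>21 a * \<alpha>12 b)) * Y1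
      + const2 (\<alpha>12 (pb a b) - pb (\<alpha>12 a) b - pb a (\<alpha>12 b) -
         (\<alpha>11 a * \<alpha>12 b - \<alpha>12 a * \<alpha>11 b + \<alpha>12 a * \<alpha>22 b - \<alpha>22 a * \<alpha>12 b)) * Y2
      + const2 (\<nu>1 (pb a b) - pb (\<nu>1 a) b - pb a (\<nu>1 b) -
         (\<alpha>11 a * \<nu>1 b - \<nu>1 a * \<alpha>11 b + \<alpha>12 a * \<nu>2 b - \<nu>2 a * \<alpha>12 b))"
    unfolding jacobiator_def
    using biderivationD(2)[OF biderivation_pb, of b "\<alpha>11 a"]
      biderivationD(2)[OF biderivation_pb, of b "\<alpha>12 a"]
      biderivationD(2)[OF biderivation_pb, of b "\<nu>1 a"]
    by (simp add: B_generators biderivation_simps[OF biderivation_B] const2_hom algebra_simps)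
  then show ?thesis
    by (simp only: const2_linear_eq_0_iff compat_Y1_def eq_iff_diff_eq_0[symmetric])
qed

lemma jacobiator_Y2_const_const: "jacobiator B Y2 (const2 a) (const2 b) = 0 \<longleftrightarrow> compat_Y2 a b"
proof -
  have "jacobiator B Y2 (const2 a) (const2 b) =
      const2 (\<alpha>21 (pb a b) - pb (\<alpha>21 a) b - pb a (\<alpha>21 b) -
         (\<alpha>21 a * \<alpha>11 b - \<alpha>11 a * \<alpha>21 b + \<alpha>22 a * \<alpha>21 b - \<alpha>21 a * \<alpha>22 b)) * Y1
      + const2 (\<alpha>22 (pb a b) - pb (\<alpha>22 a) b - pb a (\<alpha>22 b) - (\<alpha>21 a * \<alpha>12 b - \<alpha>12 a * \<alpha>21 b)) * Y2
      + const2 (\<nu>2 (pb a b) - pb (\<nu>2 a) b - pb a (\<nu>2 b) -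
         (\<alpha>21 a * \<nu>1 b - \<nu>1 a * \<alpha>21 b + \<alpha>22 a * \<nu>2 b - \<nu>2 a * \<alpha>22 b))"
    unfolding jacobiator_def
    using biderivationD(2)[OF biderivation_pb, of b "\<alpha>21 a"]
      biderivationD(2)[OF biderivation_pb, of b "\<alpha>22 a"]
      biderivationD(2)[OF biderivation_pb, of b "\<nu>2 a"]
    by (simp add: B_generators biderivation_simps[OF biderivation_B] const2_hom algebra_simps)
  then show ?thesis
    by (simp only: const2_linear_eq_0_iff compat_Y2_def eq_iff_diff_eq_0[symmetric])
qed

lemma jacobiator_Y2_Y1_const: "jacobiator B Y2 Y1 (const2 a) = 0 \<longleftrightarrow> commutator_cond a"
proof -
  \<comment> \<open>The factor \<open>2 * q11\<close> stems from the two equal terms of the Leibniz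
    rule on \<open>Y1 * Y1\<close>, and is split accordingly.\<close>
  have sc2: "sc (2 * q11) x = sc q11 1 * x + sc q11 1 * x" for x
    by (metis mult_2 scale_eq_mult scale_left_distrib)
  \<comment> \<open>Scalars are Casimir elements, so the factors \<open>q11\<close> and
    \<open>q12\<close> pass through brackets with constants.\<close>
  have *: "B (const2 b) (const2 (sc c 1)) = 0" "pb b (sc c 1) = 0" for b c
    using skew_biderivation_pb B_scalar
    by (auto simp: skew_biderivation_iff[OF commutative_algebra_axioms])
  have "jacobiator B Y2 Y1 (const2 a) =
      const2 (commutator \<alpha>21 \<alpha>11 a
        - (sc q11 1 * \<alpha>11 a + sc q12 1 * \<alpha>21 a - sc q11 1 * \<alpha>22 a)) * Y1\<^sup>2
      + const2 (commutator \<alpha>22 \<alpha>11 a + commutator \<alpha>21 \<alpha>12 a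
        - (sc q11 1 * \<alpha>12 a + sc q11 1 * \<alpha>12 a)) * (Y1 * Y2)
      + const2 (commutator \<alpha>22 \<alpha>12 a - sc q12 1 * \<alpha>12 a) * Y2\<^sup>2
      + const2 (commutator \<nu>2 \<alpha>11 a + commutator \<alpha>21 \<nu>1 a
        - (sc q11 1 * \<nu>1 a + sc q11 1 * \<nu>1 a + sc q12 1 * \<nu>2 a + w2 * \<alpha>21 a - w1 * \<alpha>22 a + pb w1 a)) * Y1
      + const2 (commutator \<nu>2 \<alpha>12 a + commutator \<alpha>22 \<nu>1 a
        - (sc q12 1 * \<nu>1 a + w1 * \<alpha>12 a - w2 * \<alpha>11 a + pb w2 a)) * Y2
      + const2 (commutator \<nu>2 \<nu>1 a
        - (w1 * \<nu>1 a + w2 * \<nu>2 a - w0 * \<alpha>11 a - w0 * \<alpha>22 a + pb w0 a))"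
    unfolding jacobiator_def commutator_def
    using biderivationD(2)[OF biderivation_pb, of a w0]
      biderivationD(2)[OF biderivation_pb, of a w1]
      biderivationD(2)[OF biderivation_pb, of a w2]
    by (simp add: B_generators B_self * biderivation_simps[OF biderivation_B] const2_hom
        power2_eq_square algebra_simps)
  then show ?thesis
    by (simp only: const2_quadratic_eq_0_iff commutator_cond_def eq_iff_diff_eq_0[symmetric] sc2
        distrib_right mult_1_right
        scale_eq_mult[of _ "\<alpha>11 a"] scale_eq_mult[of _ "\<alpha>12 a"] scale_eq_mult[of _ "\<alpha>21 a"]
        scale_eq_mult[of _ "\<alpha>22 a"] scale_eq_mult[of _ "\<nu>1 a"] scale_eq_mult[of _ "\<nu>2 a"])
qed

text \<open>The Jacobiator vanishes on all triples of generators and is a derivation in its first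
  argument. Three rounds, with a cyclic rotation in between, free the arguments one by one.\<close>

lemma jacobiator_eq_0:
  assumes compat: "\<And>a b. compat_Y1 a b \<and> compat_Y2 a b" and commutator_cond: "\<And>a. commutator_cond a"
  shows "jacobiator B x y z = 0"
proof -
  let ?G = "insert Y1 (insert Y2 (range const2))"
  have diag: "jacobiator B x x z = 0" for x z
    using biderivationD(2)[OF biderivation_B, of z x]
    by (simp add: jacobiator_def B_self biderivation_simps[OF biderivation_B]
        biderivation_0[OF biderivation_B])
  then have diag': "jacobiator B z x x = 0" "jacobiator B x z x = 0" for x z
    by (metis jacobiator_cyclic)+
  have Y: "jacobiator B Y1 (const2 a) (const2 b) = 0" "jacobiator B Y2 (const2 a) (const2 b) = 0"
    "jacobiator B Y2 Y1 (const2 a) = 0" for a b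
    using compat commutator_cond
    by (simp_all add: jacobiator_Y1_const_const jacobiator_Y2_const_const jacobiator_Y2_Y1_const)
  \<comment> \<open>Rotations of the three basic triples come first; the opposite orientation of
    \<open>Y2\<close>, \<open>Y1\<close> and a constant then needs the swap.\<close>
  then have Y': "jacobiator B (const2 a) (const2 b) Y1 = 0" "jacobiator B (const2 b) Y1 (const2 a) = 0"
    "jacobiator B (const2 a) (const2 b) Y2 = 0" "jacobiator B (const2 b) Y2 (const2 a) = 0"
    "jacobiator B Y1 (const2 a) Y2 = 0" "jacobiator B (const2 a) Y2 Y1 = 0" for a b
    by (metis jacobiator_cyclic)+
  have Y'': "jacobiator B Y2 (const2 a) Y1 = 0" "jacobiator B (const2 a) Y1 Y2 = 0"
    "jacobiator B Y1 Y2 (const2 a) = 0" for a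
    using Y Y' jacobiator_swap[OF biderivation_B] by (metis minus_zero)+
  have zero: "ring_derivation (\<lambda>x. 0 :: 'r poly poly)"
    by (simp add: ring_derivation_def)
  have "jacobiator B x y z = 0" if "x \<in> ?G" "y \<in> ?G" "z \<in> ?G" for x y z
    using that by (elim insertE rangeE) (simp_all only: diag diag' Y Y' Y'' jacobiator_const)
  \<comment> \<open>Here the first argument becomes arbitrary; rotating brings another generator
    argument into first place for the next round.\<close>
  then have "(\<lambda>x. jacobiator B x y z) = (\<lambda>x. 0)" if "y \<in> ?G" "z \<in> ?G" for y z
    by (intro ring_derivation_eqI ring_derivation_jacobiator biderivation_B zero) (use that in auto)
  then have "jacobiator B x y z = 0" if "x \<in> ?G" "z \<in> ?G" for x y z
    using that by (metis jacobiator_cyclic)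
  then have "(\<lambda>x. jacobiator B x y z) = (\<lambda>x. 0)" if "z \<in> ?G" for y z
    by (intro ring_derivation_eqI ring_derivation_jacobiator biderivation_B zero) (use that in auto)
  then have "jacobiator B x y z = 0" if "x \<in> ?G" for x y z
    using that by (metis jacobiator_cyclic)
  then have "(\<lambda>x. jacobiator B x y z) = (\<lambda>x. 0)"
    by (intro ring_derivation_eqI ring_derivation_jacobiator biderivation_B zero) auto
  then show ?thesis by meson
qed

lemma poisson_algebra_B_iff:
  "poisson_algebra (scale2 sc) B \<longleftrightarrow> (\<forall>a b. compat_Y1 a b \<and> compat_Y2 a b) \<and> (\<forall>a. commutator_cond a)"
proof
  assume "poisson_algebra (scale2 sc) B"
  then have "jacobiator B x y z = 0" for x y z
    by (simp add: poisson_algebra_iff)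
  then show "(\<forall>a b. compat_Y1 a b \<and> compat_Y2 a b) \<and> (\<forall>a. commutator_cond a)"
    by (simp flip: jacobiator_Y1_const_const jacobiator_Y2_const_const jacobiator_Y2_Y1_const)
next
  assume "(\<forall>a b. compat_Y1 a b \<and> compat_Y2 a b) \<and> (\<forall>a. commutator_cond a)"
  then show "poisson_algebra (scale2 sc) B"
    by (simp add: poisson_algebra_iff commutative_algebra_scale2 skew_B jacobiator_eq_0)
qed

text \<open>\<open>B Y1\<close> and \<open>B Y2\<close> are derivations that kill scalars.
  Restricted to constants, their values have the component maps as coefficients, and these inherit
  the property.\<close>

lemma derivation_cond_if_generator_values: "derivation_cond"
proof -
  have add: "B x (const2 (a + b)) = B x (const2 a) + B x (const2 b)" for x a b
    by (simp add: const2_hom biderivation_simps[OF biderivation_B])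
  have mult: "B x (const2 (a * b)) = B x (const2 a) * const2 b + const2 a * B x (const2 b)" for x a b
    by (simp add: const2_hom biderivation_simps[OF biderivation_B])
  \<comment> \<open>The equations are bundled in triples so that each bundle can be read backwards
    as a single identity between linear polynomials.\<close>
  have coeffs: "\<alpha>11 (a + b) = \<alpha>11 a + \<alpha>11 b \<and> \<alpha>12 (a + b) = \<alpha>12 a + \<alpha>12 b \<and> \<nu>1 (a + b) = \<nu>1 a + \<nu>1 b"
    "\<alpha>21 (a + b) = \<alpha>21 a + \<alpha>21 b \<and> \<alpha>22 (a + b) = \<alpha>22 a + \<alpha>22 b \<and> \<nu>2 (a + b) = \<nu>2 a + \<nu>2 b"
    "\<alpha>11 (a * b) = \<alpha>11 a * b + a * \<alpha>11 b \<and> \<alpha>12 (a * b) = \<alpha>12 a * b + a * \<alpha>12 b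
      \<and> \<nu>1 (a * b) = \<nu>1 a * b + a * \<nu>1 b"
    "\<alpha>21 (a * b) = \<alpha>21 a * b + a * \<alpha>21 b \<and> \<alpha>22 (a * b) = \<alpha>22 a * b + a * \<alpha>22 b
      \<and> \<nu>2 (a * b) = \<nu>2 a * b + a * \<nu>2 b" for a b
    unfolding const2_linear_eq_iff[symmetric]
    using add[of Y1 a b] add[of Y2 a b] mult[of Y1 a b] mult[of Y2 a b]
    by (simp_all only: B_generators) (simp_all add: const2_hom algebra_simps)
  have "\<alpha>11 (sc c 1) = 0 \<and> \<alpha>12 (sc c 1) = 0 \<and> \<nu>1 (sc c 1) = 0"
    "\<alpha>21 (sc c 1) = 0 \<and> \<alpha>22 (sc c 1) = 0 \<and> \<nu>2 (sc c 1) = 0" for c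
    unfolding const2_linear_eq_0_iff[symmetric]
    using B_scalar[of Y1 c] B_scalar[of Y2 c] by (simp_all only: B_generators)
  with coeffs show ?thesis
    by (simp add: derivation_cond_def derivation_iff[OF commutative_algebra_axioms] ring_derivation_def)
qed

end

section \<open>The existence criterion and the passage to matrix form\<close>

lemma ex_poisson_iff:
  "(\<exists>B. poisson_algebra (scale2 sc) B \<and> generator_values B) \<longleftrightarrow>
    derivation_cond \<and> (\<forall>a b. compat_Y1 a b \<and> compat_Y2 a b) \<and> (\<forall>a. commutator_cond a)"
proof
  assume "\<exists>B. poisson_algebra (scale2 sc) B \<and> generator_values B"
  then obtain B where B: "poisson_algebra (scale2 sc) B" "generator_values B" by blast
  then have "skew_biderivation (scale2 sc) B" by (simp add: poisson_algebra_iff)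
  with B show "derivation_cond \<and> (\<forall>a b. compat_Y1 a b \<and> compat_Y2 a b) \<and> (\<forall>a. commutator_cond a)"
    using poisson_algebra_B_iff derivation_cond_if_generator_values by blast
next
  assume *: "derivation_cond \<and> (\<forall>a b. compat_Y1 a b \<and> compat_Y2 a b) \<and> (\<forall>a. commutator_cond a)"
  then have "skew_biderivation (scale2 sc) ext_bracket" "generator_values ext_bracket"
    using skew_biderivation_ext_bracket generator_values_ext_bracket by blast+
  with * show "\<exists>B. poisson_algebra (scale2 sc) B \<and> generator_values B"
    using poisson_algebra_B_iff by blast
qed

text \<open>\<open>bracket_vec_elem\<close> is minus the bracket with the element on the left, so
  skew-symmetry of \<open>B\<close> is what recovers \<open>B Y1 (const2 a)\<close> and
  \<open>B Y2 (const2 a)\<close>.\<close>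

lemma prescribed_values_iff:
  assumes "biderivation B"
    and "\<And>a. \<alpha> a = vector [vector [\<alpha>11 a, \<alpha>12 a], vector [\<alpha>21 a, \<alpha>22 a]]"
    and "\<And>a. \<nu> a = vector [\<nu>1 a, \<nu>2 a]"
  shows "prescribed_values sc pb q11 q12 w1 w2 w0 \<alpha> \<nu> B \<longleftrightarrow> generator_values B"
proof -
  have "- B (const2 a) Y1 = B Y1 (const2 a)" "- B (const2 a) Y2 = B Y2 (const2 a)" for a
    using biderivationD(2)[OF assms(1), of "const2 a"] by simp_all
  then show ?thesis
    by (simp add: prescribed_values_def generator_values_def vec_eq_iff forall_2 assms(2,3)
        bracket_vec_elem_def bracket_elem_vec_def entrywise_def Y_def matrix_vector_mult_def sum_2 all_conj_distrib)
qed

text \<open>The definite description denotes, since \<open>ext_bracket\<close> satisfies it and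
  \<open>generator_values_unique\<close> excludes any other bracket.\<close>

lemma extension_bracket_eq:
  assumes "derivation_cond"
    and "\<And>a. \<alpha> a = vector [vector [\<alpha>11 a, \<alpha>12 a], vector [\<alpha>21 a, \<alpha>22 a]]"
    and "\<And>a. \<nu> a = vector [\<nu>1 a, \<nu>2 a]"
  shows "extension_bracket sc pb q11 q12 w1 w2 w0 \<alpha> \<nu> = ext_bracket"
proof -
  have iff: "skew_biderivation (scale2 sc) B \<and> prescribed_values sc pb q11 q12 w1 w2 w0 \<alpha> \<nu> B
      \<longleftrightarrow> skew_biderivation (scale2 sc) B \<and> generator_values B" for B
    using prescribed_values_iff[OF _ assms(2,3)]
    by (auto simp: skew_biderivation_iff[OF commutative_algebra_scale2])
  show ?thesis
    unfolding extension_bracket_def iff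
    by (rule the_equality)
      (use assms(1) skew_biderivation_ext_bracket generator_values_ext_bracket generator_values_unique
        in blast)+
qed

end

section \<open>The component form and the matrix form combined\<close>

theorem theorem2p9:
  fixes sc :: "'k::field_char_0 \<Rightarrow> 'r::comm_ring_1 \<Rightarrow> 'r"
    and pb :: "'r \<Rightarrow> 'r \<Rightarrow> 'r"
    and q11 q12 :: 'k
    and w1 w2 w0 :: 'r
    and \<alpha> :: "'r \<Rightarrow> 'r ^ 2 ^ 2" and \<alpha>11 \<alpha>12 \<alpha>21 \<alpha>22 :: "'r \<Rightarrow> 'r"
    and \<nu> :: "'r \<Rightarrow> 'r ^ 2" and \<nu>1 \<nu>2 :: "'r \<Rightarrow> 'r"
  assumes "poisson_algebra sc pb"
    and "\<And>a. \<alpha> a = vector [vector [\<alpha>11 a, \<alpha>12 a], vector [\<alpha>21 a, \<alpha>22 a]]"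
    and "\<And>a. \<nu> a = vector [\<nu>1 a, \<nu>2 a]"
    and "Vector_Spaces.linear sc (vec_scale (vec_scale sc)) \<alpha>"
    and "Vector_Spaces.linear sc (vec_scale sc) \<nu>"
  shows
    "((\<exists>B. poisson_algebra (scale2 sc) B \<and>
        (\<forall>a b. B (const2 a) (const2 b) = const2 (pb a b)) \<and>
        B Y2 Y1 = scale2 sc q11 (Y1\<^sup>2) + scale2 sc q12 (Y1 * Y2)
                    + const2 w1 * Y1 + const2 w2 * Y2 + const2 w0 \<and>
        (\<forall>a. B Y1 (const2 a) = const2 (\<alpha>11 a) * Y1 + const2 (\<alpha>12 a) * Y2 + const2 (\<nu>1 a)) \<and>
        (\<forall>a. B Y2 (const2 a) = const2 (\<alpha>21 a) * Y1 + const2 (\<alpha>22 a) * Y2 + const2 (\<nu>2 a)))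
      \<longleftrightarrow>
      (derivation sc \<alpha>11 \<and> derivation sc \<alpha>12 \<and> derivation sc \<alpha>21 \<and>
         derivation sc \<alpha>22 \<and> derivation sc \<nu>1 \<and> derivation sc \<nu>2) \<and>
      (\<forall>a b. \<alpha>11 (pb a b) - pb (\<alpha>11 a) b - pb a (\<alpha>11 b) = \<alpha>12 a * \<alpha>21 b - \<alpha>21 a * \<alpha>12 b) \<and>
      (\<forall>a b. \<alpha>22 (pb a b) - pb (\<alpha>22 a) b - pb a (\<alpha>22 b) = \<alpha>21 a * \<alpha>12 b - \<alpha>12 a * \<alpha>21 b) \<and>
      (\<forall>a b. \<alpha>12 (pb a b) - pb (\<alpha>12 a) b - pb a (\<alpha>12 b) =
         \<alpha>11 a * \<alpha>12 b - \<alpha>12 a * \<alpha>11 b + \<alpha>12 a * \<alpha>22 b - \<alpha>22 a * \<alpha>12 b) \<and>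
      (\<forall>a b. \<alpha>21 (pb a b) - pb (\<alpha>21 a) b - pb a (\<alpha>21 b) =
         \<alpha>21 a * \<alpha>11 b - \<alpha>11 a * \<alpha>21 b + \<alpha>22 a * \<alpha>21 b - \<alpha>21 a * \<alpha>22 b) \<and>
      (\<forall>a b. \<nu>1 (pb a b) - pb (\<nu>1 a) b - pb a (\<nu>1 b) =
         \<alpha>11 a * \<nu>1 b - \<nu>1 a * \<alpha>11 b + \<alpha>12 a * \<nu>2 b - \<nu>2 a * \<alpha>12 b) \<and>
      (\<forall>a b. \<nu>2 (pb a b) - pb (\<nu>2 a) b - pb a (\<nu>2 b) =
         \<alpha>21 a * \<nu>1 b - \<nu>1 a * \<alpha>21 b + \<alpha>22 a * \<nu>2 b - \<nu>2 a * \<alpha>22 b) \<and>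
      commutator \<alpha>21 \<alpha>11 =
        (\<lambda>a. sc q11 (\<alpha>11 a) + sc q12 (\<alpha>21 a) - sc q11 (\<alpha>22 a)) \<and>
      (\<lambda>a. commutator \<alpha>22 \<alpha>11 a + commutator \<alpha>21 \<alpha>12 a) = (\<lambda>a. sc (2 * q11) (\<alpha>12 a)) \<and>
      commutator \<alpha>22 \<alpha>12 = (\<lambda>a. sc q12 (\<alpha>12 a)) \<and>
      (\<lambda>a. commutator \<nu>2 \<alpha>11 a + commutator \<alpha>21 \<nu>1 a) =
        (\<lambda>a. sc (2 * q11) (\<nu>1 a) + sc q12 (\<nu>2 a) + w2 * \<alpha>21 a - w1 * \<alpha>22 a + pb w1 a) \<and>
      (\<lambda>a. commutator \<nu>2 \<alpha>12 a + commutator \<alpha>22 \<nu>1 a) =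
        (\<lambda>a. sc q12 (\<nu>1 a) + w1 * \<alpha>12 a - w2 * \<alpha>11 a + pb w2 a) \<and>
      commutator \<nu>2 \<nu>1 =
        (\<lambda>a. w1 * \<nu>1 a + w2 * \<nu>2 a - w0 * \<alpha>11 a - w0 * \<alpha>22 a + pb w0 a))
     \<and>
     ((\<exists>B. poisson_algebra (scale2 sc) B \<and>
        prescribed_values sc pb q11 q12 w1 w2 w0 \<alpha> \<nu> B)
      \<longleftrightarrow>
      (\<forall>a b. \<alpha> (a * b) = vec_scale (*s) a (\<alpha> b) + vec_scale (*s) b (\<alpha> a)) \<and>
      (\<forall>a b. \<nu> (a * b) = a *s \<nu> b + b *s \<nu> a) \<and>
      (\<forall>a b. \<alpha> (pb a b) = bracket_mat_elem pb (\<alpha> a) b + bracket_elem_mat pb a (\<alpha> b)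
                             + (\<alpha> a ** \<alpha> b - \<alpha> b ** \<alpha> a)) \<and>
      (\<forall>a b. \<nu> (pb a b) = bracket_vec_elem pb (\<nu> a) b + bracket_elem_vec pb a (\<nu> b)
                             + \<alpha> a *v \<nu> b - \<alpha> b *v \<nu> a) \<and>
      (\<forall>a. let B = extension_bracket sc pb q11 q12 w1 w2 w0 \<alpha> \<nu> in
         B Y2 (B Y1 (const2 a)) + B Y1 (B (const2 a) Y2) + B (const2 a) (B Y2 Y1) = 0))"
proof -
  interpret generator_data sc pb q11 q12 w1 w2 w0 \<alpha>11 \<alpha>12 \<alpha>21 \<alpha>22 \<nu>1 \<nu>2
    using assms(1) by (simp add: generator_data_def)
  note defs = vec_eq_iff forall_2 assms(2,3) bracket_mat_elem_def bracket_elem_mat_def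
    bracket_vec_elem_def bracket_elem_vec_def entrywise_def vec_scale_def
    matrix_vector_mult_def matrix_matrix_mult_def sum_2
  have first: "(\<exists>B. poisson_algebra (scale2 sc) B \<and> generator_values B) \<longleftrightarrow>
    derivation_cond \<and> (\<forall>a b. compat_Y1 a b \<and> compat_Y2 a b) \<and> (\<forall>a. commutator_cond a)"
    by (rule ex_poisson_iff)
  have "(\<exists>B. poisson_algebra (scale2 sc) B \<and> prescribed_values sc pb q11 q12 w1 w2 w0 \<alpha> \<nu> B) \<longleftrightarrow>
    (\<exists>B. poisson_algebra (scale2 sc) B \<and> generator_values B)"
    using prescribed_values_iff[OF _ assms(2,3)]
    by (auto simp: poisson_algebra_iff skew_biderivation_iff[OF commutative_algebra_scale2])
  moreover have "derivation_cond \<longleftrightarrow>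
      (\<forall>a b. \<alpha> (a * b) = vec_scale (*s) a (\<alpha> b) + vec_scale (*s) b (\<alpha> a)) \<and>
      (\<forall>a b. \<nu> (a * b) = a *s \<nu> b + b *s \<nu> a)"
  proof -
    \<comment> \<open>Linearity of \<alpha> and \<nu> is linearity of each entry, so only the
      Leibniz rule remains to be compared.\<close>
    have "Vector_Spaces.linear sc sc \<alpha>11" "Vector_Spaces.linear sc sc \<alpha>12"
      "Vector_Spaces.linear sc sc \<alpha>21" "Vector_Spaces.linear sc sc \<alpha>22"
      "Vector_Spaces.linear sc sc \<nu>1" "Vector_Spaces.linear sc sc \<nu>2"
      using assms(4,5) vector_space_axioms
      by (simp_all add: Vector_Spaces.linear_iff defs)
    then show ?thesis
      by (auto simp: derivation_cond_def derivation_def defs algebra_simps)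
  qed
  moreover have "(\<forall>a b. compat_Y1 a b \<and> compat_Y2 a b) \<longleftrightarrow>
      (\<forall>a b. \<alpha> (pb a b) = bracket_mat_elem pb (\<alpha> a) b + bracket_elem_mat pb a (\<alpha> b)
                             + (\<alpha> a ** \<alpha> b - \<alpha> b ** \<alpha> a)) \<and>
      (\<forall>a b. \<nu> (pb a b) = bracket_vec_elem pb (\<nu> a) b + bracket_elem_vec pb a (\<nu> b)
                             + \<alpha> a *v \<nu> b - \<alpha> b *v \<nu> a)"
  proof -
    \<comment> \<open>These undo the sign in \<open>bracket_mat_elem\<close> and
      \<open>bracket_vec_elem\<close>. In the diagonal entries of the matrix commutator the products
      of equal entries cancel by commutativity.\<close>
    have skew: "pb b (\<alpha>11 a) = - pb (\<alpha>11 a) b" "pb b (\<alpha>12 a) = - pb (\<alpha>12 a) b"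
      "pb b (\<alpha>21 a) = - pb (\<alpha>21 a) b" "pb b (\<alpha>22 a) = - pb (\<alpha>22 a) b"
      "pb b (\<nu>1 a) = - pb (\<nu>1 a) b" "pb b (\<nu>2 a) = - pb (\<nu>2 a) b" for a b
      by (rule biderivationD(2)[OF biderivation_pb])+
    show ?thesis
      unfolding all_conj_distrib[symmetric]
      by (intro all_cong1)
        (auto simp: compat_Y1_def compat_Y2_def defs skew algebra_simps)
  qed
  \<comment> \<open>The equivalence is conditional because \<open>extension_bracket\<close> is
    identified only under \<open>derivation_cond\<close>, which both sides of the final equivalence
    supply.\<close>
  moreover have "(\<forall>a. commutator_cond a) \<longleftrightarrow>
      (\<forall>a. let B = extension_bracket sc pb q11 q12 w1 w2 w0 \<alpha> \<nu> in
         B Y2 (B Y1 (const2 a)) + B Y1 (B (const2 a) Y2) + B (const2 a) (B Y2 Y1) = 0)"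
    if "derivation_cond"
    using jacobiator_Y2_Y1_const[OF skew_biderivation_ext_bracket[OF that]
        generator_values_ext_bracket[OF that]]
    by (simp add: extension_bracket_eq[OF that assms(2,3)] jacobiator_def)
  ultimately have second: "(\<exists>B. poisson_algebra (scale2 sc) B \<and>
        prescribed_values sc pb q11 q12 w1 w2 w0 \<alpha> \<nu> B)
      \<longleftrightarrow>
      (\<forall>a b. \<alpha> (a * b) = vec_scale (*s) a (\<alpha> b) + vec_scale (*s) b (\<alpha> a)) \<and>
      (\<forall>a b. \<nu> (a * b) = a *s \<nu> b + b *s \<nu> a) \<and>
      (\<forall>a b. \<alpha> (pb a b) = bracket_mat_elem pb (\<alpha> a) b + bracket_elem_mat pb a (\<alpha> b)
                             + (\<alpha> a ** \<alpha> b - \<alpha> b ** \<alpha> a)) \<and>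
      (\<forall>a b. \<nu> (pb a b) = bracket_vec_elem pb (\<nu> a) b + bracket_elem_vec pb a (\<nu> b)
                             + \<alpha> a *v \<nu> b - \<alpha> b *v \<nu> a) \<and>
      (\<forall>a. let B = extension_bracket sc pb q11 q12 w1 w2 w0 \<alpha> \<nu> in
         B Y2 (B Y1 (const2 a)) + B Y1 (B (const2 a) Y2) + B (const2 a) (B Y2 Y1) = 0)"
    using first by argo
  \<comment> \<open>With quantifiers distributed and equalities of maps read pointwise, the grouped
    conditions differ from the listed ones only in the arrangement of conjuncts.\<close>
  show ?thesis
    using first second
    unfolding generator_values_def derivation_cond_def compat_Y1_def compat_Y2_def commutator_cond_def fun_eq_iff
      all_conj_distrib
    by argo
qed

end
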